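(* Let $m\ge 1$ be an integer, let $F=\{f_i\}_{i=1}^\infty$ be an $m$-erasure robust frame for a Hilbert space $\mathcal{H}$ with analysis operator $T:\mathcal{H}\to\ell^2(\mathbb{N})$, $Tf=\{\langle f,f_i\rangle\}_{i=1}^\infty$, and let $\Gamma$ be a (possibly infinite) matrix, with columns indexed by $\mathbb{N}$, such that $T\mathcal{H}=\mathcal{N}(\Gamma)$. Then every $m$ columns of $\Gamma$ are linearly independent.
   Context: A sequence $\{f_i\}_{i\in I}$ in a Hilbert space $\mathcal{H}$ ($I$ countable) is a frame for $\mathcal{H}$ if there are constants $A,B>0$ with $A\|f\|^2\le\sum_{i\in I}|\langle f,f_i\rangle|^2\le B\|f\|^2$ for all $f\in\mathcal{H}$. A frame $\{f_i\}_{i=1}^\infty$ for $\mathcal{H}$ is $m$-erasure robust if for every $\Lambda\subset\mathbb{N}$ with $|\Lambda|=m$ the family $\{f_i\}_{i\in\mathbb{N}\setminus\Lambda}$ is a frame for $\mathcal{H}$. $\mathcal{N}(\Gamma)$ denotes the null space of $\Gamma$, i.e. the set of $\alpha=(\alpha_1,\alpha_2,\dots)^t\in\ell^2(\mathbb{N})$ with $\Gamma\alpha=0$ (each row sum converging to $0$). *)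

theory Defs
  imports "HOL-Analysis.Analysis" "HOL-Library.Function_Algebras"
begin

(* Scalar fields of Hilbert spaces.  The last axiom leaves only the real field (with the
   identity as conjugation) and the complex field (with complex conjugation). *)
class scalar_field = real_normed_field +
  fixes conj :: "'a \<Rightarrow> 'a"
  assumes conj_add: "conj (x + y) = conj x + conj y"
    and conj_mult: "conj (x * y) = conj x * conj y"
    and conj_mult_self: "conj x * x = (norm x)\<^sup>2 *\<^sub>R 1"

instantiation real :: scalar_field
begin
definition conj_real :: "real \<Rightarrow> real" where "conj_real x = x"
instance by standard (simp_all add: conj_real_def power2_eq_square)
end

instantiation complex :: scalar_field
begin
definition conj_complex :: "complex \<Rightarrow> complex" where "conj_complex = cnj"
instance
proof
  fix x y :: complex
  show "conj x * x = (norm x)\<^sup>2 *\<^sub>R 1"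
    using complex_norm_square[of x] by (simp only: conj_complex_def scaleR_conv_of_real mult.commute mult_1_left mult_1_right)
qed (simp_all add: conj_complex_def)
end

(* Completeness is the sort banach; the inner product, linear in its first argument,
   induces the norm of the type. *)
locale hilbert_space = vector_space scale
  for scale :: "'k::scalar_field \<Rightarrow> 'h::banach \<Rightarrow> 'h" +
  fixes ip :: "'h \<Rightarrow> 'h \<Rightarrow> 'k"
  assumes scale_of_real: "scale (of_real r) x = r *\<^sub>R x"
    and ip_add_left: "ip (x + y) z = ip x z + ip y z"
    and ip_scale_left: "ip (scale c x) y = c * ip x y"
    and ip_commute: "ip y x = conj (ip x y)"
    and ip_self: "ip x x = of_real ((norm x)\<^sup>2)"

lemma hilbert_space_real:
  "hilbert_space (scaleR :: real \<Rightarrow> 'h::{real_inner, banach} \<Rightarrow> 'h) inner"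
proof
  fix x y :: 'h
  show "y \<bullet> x = conj (x \<bullet> y)"
    by (simp only: conj_real_def inner_commute)
qed (simp_all add: inner_add_left power2_norm_eq_inner scaleR_add_right scaleR_add_left)

lemma hilbert_space_complex:
  "hilbert_space ((*) :: complex \<Rightarrow> complex \<Rightarrow> complex) (\<lambda>x y. x * cnj y)"
proof
  fix x :: complex
  show "x * cnj x = of_real ((norm x)\<^sup>2)"
    by (rule complex_norm_square [symmetric])
qed (simp_all add: conj_complex_def scaleR_conv_of_real distrib_left distrib_right)

definition is_frame :: "('h::real_normed_vector \<Rightarrow> 'h \<Rightarrow> 'k::scalar_field) \<Rightarrow> ('i \<Rightarrow> 'h) \<Rightarrow> 'i set \<Rightarrow> bool"
  where "is_frame ip f I \<longleftrightarrow> countable I \<and>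
    (\<exists>A>0. \<exists>B>0. \<forall>x.
       (\<lambda>i. (norm (ip x (f i)))\<^sup>2) summable_on I \<and>
       A * (norm x)\<^sup>2 \<le> (\<Sum>\<^sub>\<infinity>i\<in>I. (norm (ip x (f i)))\<^sup>2) \<and>
       (\<Sum>\<^sub>\<infinity>i\<in>I. (norm (ip x (f i)))\<^sup>2) \<le> B * (norm x)\<^sup>2)"

definition erasure_robust_frame ::
  "nat \<Rightarrow> ('h::real_normed_vector \<Rightarrow> 'h \<Rightarrow> 'k::scalar_field) \<Rightarrow> (nat \<Rightarrow> 'h) \<Rightarrow> bool"
  where "erasure_robust_frame m ip f \<longleftrightarrow> is_frame ip f UNIV \<and>
    (\<forall>\<Lambda>. finite \<Lambda> \<and> card \<Lambda> = m \<longrightarrow> is_frame ip f (UNIV - \<Lambda>))"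

definition analysis_op :: "('h \<Rightarrow> 'h \<Rightarrow> 'k) \<Rightarrow> (nat \<Rightarrow> 'h) \<Rightarrow> 'h \<Rightarrow> (nat \<Rightarrow> 'k)"
  where "analysis_op ip f x = (\<lambda>i. ip x (f i))"

definition ell2 :: "(nat \<Rightarrow> 'k::real_normed_field) set"
  where "ell2 = {\<alpha>. summable (\<lambda>i. (norm (\<alpha> i))\<^sup>2)}"

(* The row sums are ordinary, possibly conditionally convergent, series. *)
definition null_space :: "('r \<Rightarrow> nat \<Rightarrow> 'k::real_normed_field) \<Rightarrow> (nat \<Rightarrow> 'k) set"
  where "null_space \<Gamma> = {\<alpha> \<in> ell2. \<forall>r. (\<lambda>i. \<Gamma> r i * \<alpha> i) sums 0}"

definition col :: "('r \<Rightarrow> nat \<Rightarrow> 'k) \<Rightarrow> nat \<Rightarrow> ('r \<Rightarrow> 'k)"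
  where "col \<Gamma> i = (\<lambda>r. \<Gamma> r i)"

(* Independence of columns as an indexed family: injectivity makes repeated columns dependent. *)
definition independent_cols :: "('r \<Rightarrow> nat \<Rightarrow> 'k::field) \<Rightarrow> nat set \<Rightarrow> bool"
  where "independent_cols \<Gamma> \<Lambda> \<longleftrightarrow> inj_on (col \<Gamma>) \<Lambda> \<and>
    \<not> module.dependent (\<lambda>(c::'k) v r. c * v r) (col \<Gamma> ` \<Lambda>)"

end

theory Submission
  imports Defs
begin

text \<open>
  A linear relation among the columns indexed by \<open>\<Lambda>\<close> is an element of the null space supported
  on \<open>\<Lambda>\<close>, hence the coefficient sequence of some \<open>x\<close> orthogonal to all \<open>f\<^sub>i\<close> with \<open>i \<notin> \<Lambda>\<close>. As
  these \<open>f\<^sub>i\<close> still form a frame, the lower frame bound forces \<open>x = 0\<close>, so the relation is trivial.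
\<close>

lemma frame_orthogonal_imp_zero:
  assumes "is_frame ip f I" and "\<And>i. i \<in> I \<Longrightarrow> ip x (f i) = 0"
  shows "x = 0"
proof -
  obtain A where "A > 0"
    and "A * (norm x)\<^sup>2 \<le> (\<Sum>\<^sub>\<infinity>i\<in>I. (norm (ip x (f i)))\<^sup>2)"
    using assms(1) unfolding is_frame_def by blast
  moreover have "(\<Sum>\<^sub>\<infinity>i\<in>I. (norm (ip x (f i)))\<^sup>2) = 0"
    by (rule infsum_0) (simp add: assms(2))
  ultimately have "(norm x)\<^sup>2 \<le> 0"
    by (simp add: mult_le_0_iff)
  then show ?thesis by simp
qed

lemma (in hilbert_space) ip_zero_left: "ip 0 y = 0"
  using ip_add_left[of 0 0 y] by simp

text \<open>With finite support, square summability and every row series reduce to finite sums, so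
  the rows of \<open>\<Gamma>\<close> need no decay.\<close>

lemma finite_support_in_null_space:
  assumes "finite \<Lambda>" and "\<And>i. i \<notin> \<Lambda> \<Longrightarrow> \<alpha> i = 0"
    and "\<And>r. (\<Sum>i\<in>\<Lambda>. \<Gamma> r i * \<alpha> i) = 0"
  shows "\<alpha> \<in> null_space \<Gamma>"
proof -
  have "summable (\<lambda>i. (norm (\<alpha> i))\<^sup>2)"
    by (rule summable_finite[OF assms(1)]) (simp add: assms(2))
  moreover have "(\<lambda>i. \<Gamma> r i * \<alpha> i) sums 0" for r
    using sums_finite[OF assms(1), of "\<lambda>i. \<Gamma> r i * \<alpha> i"] assms(2,3) by simp
  ultimately show ?thesis
    by (simp add: null_space_def ell2_def)
qed

lemma sum_fun_apply: "(\<Sum>i\<in>S. g i) r = (\<Sum>i\<in>S. g i r)"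
  by (induction S rule: infinite_finite_induct) simp_all

text \<open>Passes from independence of a set of columns, plus injectivity, to coefficients indexed
  by \<open>\<Lambda>\<close>; the values of \<open>c\<close> off \<open>\<Lambda>\<close> are
  arbitrary.\<close>

lemma independent_colsI:
  fixes \<Gamma> :: "'r \<Rightarrow> nat \<Rightarrow> 'k::field"
  assumes fin: "finite \<Lambda>"
    and triv: "\<And>c i. \<lbrakk>\<And>r. (\<Sum>i\<in>\<Lambda>. \<Gamma> r i * c i) = 0; i \<in> \<Lambda>\<rbrakk> \<Longrightarrow> c i = 0"
  shows "independent_cols \<Gamma> \<Lambda>"
  unfolding independent_cols_def
proof
  show inj: "inj_on (col \<Gamma>) \<Lambda>"
  proof (rule inj_onI, rule ccontr)
    fix i j assume ij: "i \<in> \<Lambda>" "j \<in> \<Lambda>" "col \<Gamma> i = col \<Gamma> j" "i \<noteq> j"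
    \<comment> \<open>Two equal columns satisfy the relation with coefficients 1 at \<open>i\<close>
      and -1 at \<open>j\<close>.\<close>
    define c :: "nat \<Rightarrow> 'k" where "c k = (if k = i then 1 else 0) - (if k = j then 1 else 0)" for k
    have "\<Gamma> r i = \<Gamma> r j" for r
      using ij(3) by (simp add: col_def fun_eq_iff)
    then have "(\<Sum>k\<in>\<Lambda>. \<Gamma> r k * c k) = 0" for r
      using ij(1,2) fin
      by (simp add: c_def right_diff_distrib sum_subtractf if_distrib[of "\<lambda>x. _ * x"] sum.delta cong: if_cong)
    from triv[OF this ij(1)] show False
      using ij(4) by (simp add: c_def)
  qed
  \<comment> \<open>The pointwise scaling from \<open>independent_cols\<close>, so that
    \<open>dependent_finite\<close> applies to the notion used there.\<close>
  interpret module "\<lambda>(c::'k) (v :: 'r \<Rightarrow> 'k) r. c * v r"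
    by unfold_locales (simp_all add: fun_eq_iff algebra_simps)
  show "\<not> dependent (col \<Gamma> ` \<Lambda>)"
  proof
    assume "dependent (col \<Gamma> ` \<Lambda>)"
    then obtain u j where j: "j \<in> \<Lambda>" "u (col \<Gamma> j) \<noteq> 0"
      and u: "(\<Sum>v\<in>col \<Gamma> ` \<Lambda>. (\<lambda>r. u v * v r)) = 0"
      using fin by (auto simp: dependent_finite)
    \<comment> \<open>By injectivity the sum over the set of columns becomes a sum over
      \<open>\<Lambda>\<close>; evaluating this identity of functions at \<open>r\<close> gives the
      row equation.\<close>
    have "(\<Sum>i\<in>\<Lambda>. \<Gamma> r i * u (col \<Gamma> i)) = 0" for r
      using fun_cong[OF u[unfolded sum.reindex[OF inj]], of r]
      by (simp add: sum_fun_apply col_def mult.commute)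
    from triv[OF this j(1)] j(2) show False by simp
  qed
qed

theorem proposition4p2:
  fixes m :: nat
    and scale :: "'k::scalar_field \<Rightarrow> 'h::banach \<Rightarrow> 'h"
    and ip :: "'h \<Rightarrow> 'h \<Rightarrow> 'k"
    and F :: "nat \<Rightarrow> 'h"
    and \<Gamma> :: "'r::countable \<Rightarrow> nat \<Rightarrow> 'k"
  assumes "m \<ge> 1"
    and "hilbert_space scale ip"
    and "erasure_robust_frame m ip F"
    and "range (analysis_op ip F) = null_space \<Gamma>"
  shows "\<forall>\<Lambda>. finite \<Lambda> \<and> card \<Lambda> = m \<longrightarrow> independent_cols \<Gamma> \<Lambda>"
proof (intro allI impI, elim conjE)
  fix \<Lambda> :: "nat set"
  assume fin: "finite \<Lambda>" and card: "card \<Lambda> = m"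
  interpret hilbert_space scale ip by (rule assms(2))
  have frame: "is_frame ip F (UNIV - \<Lambda>)"
    using assms(3) fin card by (simp add: erasure_robust_frame_def)
  show "independent_cols \<Gamma> \<Lambda>"
  proof (rule independent_colsI[OF fin])
    fix c i
    assume c: "\<And>r. (\<Sum>i\<in>\<Lambda>. \<Gamma> r i * c i) = 0" and i: "i \<in> \<Lambda>"
    \<comment> \<open>Truncation is needed because \<open>c\<close> is unconstrained off
      \<open>\<Lambda>\<close> and may fail to be square summable.\<close>
    define \<alpha> where "\<alpha> k = (if k \<in> \<Lambda> then c k else 0)" for k
    have "\<alpha> \<in> null_space \<Gamma>"
      by (rule finite_support_in_null_space[OF fin]) (simp_all add: \<alpha>_def c cong: sum.cong)
    then obtain x where x: "\<And>k. \<alpha> k = ip x (F k)"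
      unfolding assms(4)[symmetric] by (auto simp: analysis_op_def)
    \<comment> \<open>Off \<open>\<Lambda>\<close> the coefficients \<open>ip x (F k)\<close> equal
      \<open>\<alpha> k\<close>, which is 0 there.\<close>
    have "x = 0"
      by (rule frame_orthogonal_imp_zero[OF frame]) (simp add: x[symmetric] \<alpha>_def)
    then have "\<alpha> i = 0"
      by (simp add: x ip_zero_left)
    then show "c i = 0"
      using i by (simp add: \<alpha>_def)
  qed
qed

end
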